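(* Let $\mathcal C$ be a proper (left and right) model category and let $Q$ be a (not necessarily functorial) homotopy localization construction in $\mathcal C$, with maps $\eta_X\colon X\to QX$. Suppose that: (a) for every map $f\colon X\to Y$ in $\mathcal C$, $\eta_Y f=Qf\,\eta_X$; (b) any retract of a $Q$-equivalence is a $Q$-equivalence; (c) $Q$-equivalences satisfy the 2-out-of-3 property; (d) for every commutative square in $\mathcal C$ with maps $f_{12}\colon X_1\to X_2$, $f_{13}\colon X_1\to X_3$, $f_{24}\colon X_2\to X_4$, $f_{34}\colon X_3\to X_4$ there exists a commutative cube with front face this square, back face a commutative square with maps $Q'f_{ab}\colon Q'X_a\to Q'X_b$ (for the same four pairs $ab$), and connecting maps $X_a\to Q'X_a$, such that each $X_a\to Q'X_a$ factors as $\eta_{X_a}\colon X_a\to QX_a$ followed by a weak equivalence $QX_a\to Q'X_a$, and each $Q'f_{ab}$ is a weak equivalence if and only if $Qf_{ab}$ is; (e) in every pullback square $$\begin{array}{ccc} W&\longrightarrow& X\\ {\scriptstyle g}\downarrow&&\downarrow{\scriptstyle f}\\ Z&\xrightarrow{\ h\ }&Y\end{array}$$ in which $h$ is a $Q$-fibration and $f$ is a $Q$-equivalence, $g$ is a $Q$-equivalence. Then $\mathcal C$ equipped with the $Q$-equivalences as weak equivalences, the $Q$-cofibrations as cofibrations and the $Q$-fibrations as fibrations is a right proper model category. Moreover, a map $f\colon X\to Y$ in $\mathcal C$ is a $Q$-fibration if $f$ is a fibration and the square $$\begin{array}{ccc} X&\xrightarrow{\eta_X}& QX\\ {\scriptstyle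 f}\downarrow&&\downarrow{\scriptstyle Qf}\\ Y&\xrightarrow{\eta_Y}&QY\end{array}$$ is a homotopy pullback square in $\mathcal C$. Conversely, every $Q$-fibration $f$ is a fibration for which this square is a homotopy pullback, under the following additional assumption: (d* ) in (d) the cube can be chosen so that in addition every morphism of maps $f_{ab}\to Q'f_{ab}$ given by the cube factors through the morphism of maps $(\eta_{X_a},\eta_{X_b})\colon f_{ab}\to Qf_{ab}$.
   Context: A homotopy localization construction $Q$ in a model category $\mathcal C$ is an assignment of a map $\eta_X\colon X\to QX$ to every $X\in\mathcal C$ and of a map $Qf\colon QX\to QY$ to every map $f\colon X\to Y$ in $\mathcal C$ (no functoriality is required), such that for all $X$ the maps $\eta_{QX},Q\eta_X\colon QX\to QQX$ are weak equivalences, and $Qf$ is a weak equivalence whenever $f$ is. A map $f$ is a $Q$-equivalence if $Qf$ is a weak equivalence; a $Q$-cofibration if it is a cofibration in $\mathcal C$; a $Q$-fibration if it has the right lifting property with respect to all maps that are both $Q$-cofibrations and $Q$-equivalences. A morphism of maps $f\to g$ is a commutative square. *)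

theory Defs
  imports Main
begin

section \<open>Categories, squares and limits\<close>

record ('o, 'a) cat =
  Obj :: "'o set"
  Arr :: "'a set"
  Dom :: "'a \<Rightarrow> 'o"
  Cod :: "'a \<Rightarrow> 'o"
  Ident :: "'o \<Rightarrow> 'a"
  Comp :: "'a \<Rightarrow> 'a \<Rightarrow> 'a" (infixr "\<cdot>\<index>" 70)

definition Hom :: "('o, 'a) cat \<Rightarrow> 'o \<Rightarrow> 'o \<Rightarrow> 'a set" where
  "Hom C X Y = {f \<in> Arr C. Dom C f = X \<and> Cod C f = Y}"

locale category =
  fixes C :: "('o, 'a) cat"
  assumes Dom_closed: "f \<in> Arr C \<Longrightarrow> Dom C f \<in> Obj C"
    and Cod_closed: "f \<in> Arr C \<Longrightarrow> Cod C f \<in> Obj C"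
    and Ident_in_Hom: "X \<in> Obj C \<Longrightarrow> Ident C X \<in> Hom C X X"
    and Comp_in_Hom: "f \<in> Hom C X Y \<Longrightarrow> g \<in> Hom C Y Z \<Longrightarrow> g \<cdot>\<^bsub>C\<^esub> f \<in> Hom C X Z"
    and Ident_left: "f \<in> Hom C X Y \<Longrightarrow> Ident C Y \<cdot>\<^bsub>C\<^esub> f = f"
    and Ident_right: "f \<in> Hom C X Y \<Longrightarrow> f \<cdot>\<^bsub>C\<^esub> Ident C X = f"
    and Comp_assoc: "f \<in> Hom C X Y \<Longrightarrow> g \<in> Hom C Y Z \<Longrightarrow> h \<in> Hom C Z V \<Longrightarrow>
           (h \<cdot>\<^bsub>C\<^esub> g) \<cdot>\<^bsub>C\<^esub> f = h \<cdot>\<^bsub>C\<^esub> (g \<cdot>\<^bsub>C\<^esub> f)"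

definition op_cat :: "('o, 'a) cat \<Rightarrow> ('o, 'a) cat" where
  "op_cat C = \<lparr>Obj = Obj C, Arr = Arr C, Dom = Cod C, Cod = Dom C, Ident = Ident C,
               Comp = (\<lambda>g f. f \<cdot>\<^bsub>C\<^esub> g)\<rparr>"

text \<open>In \<open>square C t l r b\<close> and everywhere below, the arguments \<open>t\<close>, \<open>l\<close>, \<open>r\<close>, \<open>b\<close> are
  the top, left, right and bottom map; \<open>t\<close> and \<open>b\<close> point to the right, \<open>l\<close> and \<open>r\<close> point down.
  Thus a morphism of maps \<open>(a, b) : f \<rightarrow> g\<close> is a square \<open>square C a f g b\<close>.\<close>

definition square :: "('o, 'a) cat \<Rightarrow> 'a \<Rightarrow> 'a \<Rightarrow> 'a \<Rightarrow> 'a \<Rightarrow> bool" where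
  "square C t l r b \<longleftrightarrow>
     {t, l, r, b} \<subseteq> Arr C \<and>
     Dom C t = Dom C l \<and> Cod C t = Dom C r \<and> Cod C l = Dom C b \<and> Cod C r = Cod C b \<and>
     r \<cdot>\<^bsub>C\<^esub> t = b \<cdot>\<^bsub>C\<^esub> l"

definition is_pullback :: "('o, 'a) cat \<Rightarrow> 'a \<Rightarrow> 'a \<Rightarrow> 'a \<Rightarrow> 'a \<Rightarrow> bool" where
  "is_pullback C t l r b \<longleftrightarrow>
     square C t l r b \<and>
     (\<forall>x y. square C x y r b \<longrightarrow>
        (\<exists>!h. h \<in> Hom C (Dom C x) (Dom C t) \<and> t \<cdot>\<^bsub>C\<^esub> h = x \<and> l \<cdot>\<^bsub>C\<^esub> h = y))"

definition is_pushout :: "('o, 'a) cat \<Rightarrow> 'a \<Rightarrow> 'a \<Rightarrow> 'a \<Rightarrow> 'a \<Rightarrow> bool" where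
  "is_pushout C t l r b \<longleftrightarrow>
     square C t l r b \<and>
     (\<forall>x y. square C t l x y \<longrightarrow>
        (\<exists>!h. h \<in> Hom C (Cod C r) (Cod C x) \<and> h \<cdot>\<^bsub>C\<^esub> r = x \<and> h \<cdot>\<^bsub>C\<^esub> b = y))"

definition is_diagram ::
  "('j, 'i) cat \<Rightarrow> ('o, 'a) cat \<Rightarrow> ('j \<Rightarrow> 'o) \<Rightarrow> ('i \<Rightarrow> 'a) \<Rightarrow> bool" where
  "is_diagram J C F\<^sub>o F\<^sub>a \<longleftrightarrow>
     (\<forall>j\<in>Obj J. F\<^sub>o j \<in> Obj C) \<and>
     (\<forall>u\<in>Arr J. F\<^sub>a u \<in> Hom C (F\<^sub>o (Dom J u)) (F\<^sub>o (Cod J u))) \<and>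
     (\<forall>j\<in>Obj J. F\<^sub>a (Ident J j) = Ident C (F\<^sub>o j)) \<and>
     (\<forall>u\<in>Arr J. \<forall>v\<in>Arr J. Cod J u = Dom J v \<longrightarrow> F\<^sub>a (v \<cdot>\<^bsub>J\<^esub> u) = F\<^sub>a v \<cdot>\<^bsub>C\<^esub> F\<^sub>a u)"

definition is_cone ::
  "('j, 'i) cat \<Rightarrow> ('o, 'a) cat \<Rightarrow> ('j \<Rightarrow> 'o) \<Rightarrow> ('i \<Rightarrow> 'a) \<Rightarrow> 'o \<Rightarrow> ('j \<Rightarrow> 'a) \<Rightarrow> bool" where
  "is_cone J C F\<^sub>o F\<^sub>a X p \<longleftrightarrow>
     X \<in> Obj C \<and>
     (\<forall>j\<in>Obj J. p j \<in> Hom C X (F\<^sub>o j)) \<and>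
     (\<forall>u\<in>Arr J. F\<^sub>a u \<cdot>\<^bsub>C\<^esub> p (Dom J u) = p (Cod J u))"

definition is_limit ::
  "('j, 'i) cat \<Rightarrow> ('o, 'a) cat \<Rightarrow> ('j \<Rightarrow> 'o) \<Rightarrow> ('i \<Rightarrow> 'a) \<Rightarrow> 'o \<Rightarrow> ('j \<Rightarrow> 'a) \<Rightarrow> bool" where
  "is_limit J C F\<^sub>o F\<^sub>a X p \<longleftrightarrow>
     is_cone J C F\<^sub>o F\<^sub>a X p \<and>
     (\<forall>Y q. is_cone J C F\<^sub>o F\<^sub>a Y q \<longrightarrow>
        (\<exists>!h. h \<in> Hom C Y X \<and> (\<forall>j\<in>Obj J. p j \<cdot>\<^bsub>C\<^esub> h = q j)))"

text \<open>Smallness of diagrams is measured by a cardinal \<open>\<kappa>\<close>: the limits in question are those of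
  diagrams indexed by categories with fewer than \<open>\<kappa>\<close> arrows (hence fewer than \<open>\<kappa>\<close> objects). Every
  such category has a copy whose objects and arrows are elements of the type carrying \<open>\<kappa>\<close>.\<close>

definition has_limits :: "'i rel \<Rightarrow> ('o, 'a) cat \<Rightarrow> bool" where
  "has_limits \<kappa> C \<longleftrightarrow>
     (\<forall>(J :: ('i, 'i) cat) F\<^sub>o F\<^sub>a.
        category J \<and> (card_of (Arr J), \<kappa>) \<in> ordLess \<and> is_diagram J C F\<^sub>o F\<^sub>a \<longrightarrow>
        (\<exists>X p. is_limit J C F\<^sub>o F\<^sub>a X p))"

text \<open>The index categories range over a class closed under passing to opposites, so
  limits in the opposite category are exactly the colimits of the original one.\<close>

definition has_colimits :: "'i rel \<Rightarrow> ('o, 'a) cat \<Rightarrow> bool" where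
  "has_colimits \<kappa> C \<longleftrightarrow> has_limits \<kappa> (op_cat C)"

section \<open>Model categories\<close>

definition two_out_of_three :: "('o, 'a) cat \<Rightarrow> 'a set \<Rightarrow> bool" where
  "two_out_of_three C W \<longleftrightarrow>
     (\<forall>f\<in>Arr C. \<forall>g\<in>Arr C. Cod C f = Dom C g \<longrightarrow>
        (f \<in> W \<and> g \<in> W \<longrightarrow> g \<cdot>\<^bsub>C\<^esub> f \<in> W) \<and>
        (f \<in> W \<and> g \<cdot>\<^bsub>C\<^esub> f \<in> W \<longrightarrow> g \<in> W) \<and>
        (g \<in> W \<and> g \<cdot>\<^bsub>C\<^esub> f \<in> W \<longrightarrow> f \<in> W))"

definition is_retract_of :: "('o, 'a) cat \<Rightarrow> 'a \<Rightarrow> 'a \<Rightarrow> bool" where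
  "is_retract_of C f g \<longleftrightarrow>
     (\<exists>a b c d. square C a f g b \<and> square C c g f d \<and>
        c \<cdot>\<^bsub>C\<^esub> a = Ident C (Dom C f) \<and> d \<cdot>\<^bsub>C\<^esub> b = Ident C (Cod C f))"

definition closed_under_retracts :: "('o, 'a) cat \<Rightarrow> 'a set \<Rightarrow> bool" where
  "closed_under_retracts C S \<longleftrightarrow> (\<forall>f g. g \<in> S \<and> is_retract_of C f g \<longrightarrow> f \<in> S)"

definition has_lifting :: "('o, 'a) cat \<Rightarrow> 'a \<Rightarrow> 'a \<Rightarrow> bool" where
  "has_lifting C i p \<longleftrightarrow>
     (\<forall>t b. square C t i p b \<longrightarrow>
        (\<exists>h\<in>Hom C (Cod C i) (Dom C p). h \<cdot>\<^bsub>C\<^esub> i = t \<and> p \<cdot>\<^bsub>C\<^esub> h = b))"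

definition has_factorizations :: "('o, 'a) cat \<Rightarrow> 'a set \<Rightarrow> 'a set \<Rightarrow> bool" where
  "has_factorizations C L R \<longleftrightarrow>
     (\<forall>f\<in>Arr C. \<exists>i\<in>L. \<exists>p\<in>R. Cod C i = Dom C p \<and> p \<cdot>\<^bsub>C\<^esub> i = f)"

text \<open>The choice \<open>\<kappa> = natLeq\<close> gives finite limits and colimits, as in Quillen's original
  definition; for \<open>\<kappa>\<close> the cardinality of a universe one gets all small limits and colimits.
  Factorizations are not required to be functorial.\<close>

locale model_category = category C
  for \<kappa> :: "'i rel" and C :: "('o, 'a) cat" and W Cof Fib :: "'a set" +
  assumes Card_order_kappa: "Card_order \<kappa>"
    and infinite_kappa: "infinite (Field \<kappa>)"
    and limits: "has_limits \<kappa> C"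
    and colimits: "has_colimits \<kappa> C"
    and W_subset: "W \<subseteq> Arr C"
    and Cof_subset: "Cof \<subseteq> Arr C"
    and Fib_subset: "Fib \<subseteq> Arr C"
    and W_two_out_of_three: "two_out_of_three C W"
    and W_retracts: "closed_under_retracts C W"
    and Cof_retracts: "closed_under_retracts C Cof"
    and Fib_retracts: "closed_under_retracts C Fib"
    and lifting_Cof_trivial_Fib: "i \<in> Cof \<Longrightarrow> p \<in> Fib \<inter> W \<Longrightarrow> has_lifting C i p"
    and lifting_trivial_Cof_Fib: "i \<in> Cof \<inter> W \<Longrightarrow> p \<in> Fib \<Longrightarrow> has_lifting C i p"
    and factorization_Cof_trivial_Fib: "has_factorizations C Cof (Fib \<inter> W)"
    and factorization_trivial_Cof_Fib: "has_factorizations C (Cof \<inter> W) Fib"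

definition left_proper :: "('o, 'a) cat \<Rightarrow> 'a set \<Rightarrow> 'a set \<Rightarrow> bool" where
  "left_proper C W Cof \<longleftrightarrow>
     (\<forall>t l r b. is_pushout C t l r b \<and> t \<in> Cof \<and> l \<in> W \<longrightarrow> r \<in> W)"

definition right_proper :: "('o, 'a) cat \<Rightarrow> 'a set \<Rightarrow> 'a set \<Rightarrow> bool" where
  "right_proper C W Fib \<longleftrightarrow>
     (\<forall>t l r b. is_pullback C t l r b \<and> b \<in> Fib \<and> r \<in> W \<longrightarrow> l \<in> W)"

text \<open>The right map is factored as \<open>r = p \<cdot> j\<close>, a weak equivalence followed by a fibration, and the
  comparison map \<open>k\<close> to the pullback of \<open>p\<close> along the bottom map is required to be a weak
  equivalence. In a right proper model category the condition depends neither on the chosen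
  factorization nor on which of the two maps into the lower right corner is replaced.\<close>

definition is_homotopy_pullback ::
  "('o, 'a) cat \<Rightarrow> 'a set \<Rightarrow> 'a set \<Rightarrow> 'a \<Rightarrow> 'a \<Rightarrow> 'a \<Rightarrow> 'a \<Rightarrow> bool" where
  "is_homotopy_pullback C W Fib t l r b \<longleftrightarrow>
     square C t l r b \<and>
     (\<exists>j\<in>W. \<exists>p\<in>Fib. \<exists>t' l'. \<exists>k\<in>W.
        Cod C j = Dom C p \<and> p \<cdot>\<^bsub>C\<^esub> j = r \<and>
        is_pullback C t' l' p b \<and>
        k \<in> Hom C (Dom C t) (Dom C t') \<and> t' \<cdot>\<^bsub>C\<^esub> k = j \<cdot>\<^bsub>C\<^esub> t \<and> l' \<cdot>\<^bsub>C\<^esub> k = l)"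

section \<open>Homotopy localization constructions\<close>

locale homotopy_localization = model_category \<kappa> C W Cof Fib
  for \<kappa> :: "'i rel" and C :: "('o, 'a) cat" and W Cof Fib :: "'a set" +
  fixes Qo :: "'o \<Rightarrow> 'o" and Qa :: "'a \<Rightarrow> 'a" and \<eta> :: "'o \<Rightarrow> 'a"
  assumes Qo_closed: "X \<in> Obj C \<Longrightarrow> Qo X \<in> Obj C"
    and Qa_in_Hom: "f \<in> Hom C X Y \<Longrightarrow> Qa f \<in> Hom C (Qo X) (Qo Y)"
    and eta_in_Hom: "X \<in> Obj C \<Longrightarrow> \<eta> X \<in> Hom C X (Qo X)"
    and eta_Q_in_W: "X \<in> Obj C \<Longrightarrow> \<eta> (Qo X) \<in> W"
    and Q_eta_in_W: "X \<in> Obj C \<Longrightarrow> Qa (\<eta> X) \<in> W"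
    and Q_preserves_W: "f \<in> W \<Longrightarrow> Qa f \<in> W"

definition Q_equivalences :: "('o, 'a) cat \<Rightarrow> 'a set \<Rightarrow> ('a \<Rightarrow> 'a) \<Rightarrow> 'a set" where
  "Q_equivalences C W Qa = {f \<in> Arr C. Qa f \<in> W}"

definition Q_cofibrations :: "'a set \<Rightarrow> 'a set" where
  "Q_cofibrations Cof = Cof"

definition Q_fibrations :: "('o, 'a) cat \<Rightarrow> 'a set \<Rightarrow> 'a set \<Rightarrow> ('a \<Rightarrow> 'a) \<Rightarrow> 'a set" where
  "Q_fibrations C W Cof Qa =
     {p \<in> Arr C. \<forall>i \<in> Q_cofibrations Cof \<inter> Q_equivalences C W Qa. has_lifting C i p}"

text \<open>A cube with front face \<open>(f12, f13, f24, f34)\<close>, back face \<open>(g12, g13, g24, g34)\<close> (the maps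
  \<open>Q'f\<^sub>a\<^sub>b\<close>) and connecting maps \<open>c1, c2, c3, c4\<close>. The maps \<open>w\<close> need not be compatible with the
  \<open>g\<^sub>a\<^sub>b\<close> and the \<open>Qa f\<^sub>a\<^sub>b\<close>.\<close>

definition localization_cube ::
  "('o, 'a) cat \<Rightarrow> 'a set \<Rightarrow> ('o \<Rightarrow> 'o) \<Rightarrow> ('a \<Rightarrow> 'a) \<Rightarrow> ('o \<Rightarrow> 'a) \<Rightarrow>
   'a \<Rightarrow> 'a \<Rightarrow> 'a \<Rightarrow> 'a \<Rightarrow> 'a \<Rightarrow> 'a \<Rightarrow> 'a \<Rightarrow> 'a \<Rightarrow> 'a \<Rightarrow> 'a \<Rightarrow> 'a \<Rightarrow> 'a \<Rightarrow> bool" where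
  "localization_cube C W Qo Qa \<eta> f12 f13 f24 f34 g12 g13 g24 g34 c1 c2 c3 c4 \<longleftrightarrow>
     square C f12 f13 f24 f34 \<and> square C g12 g13 g24 g34 \<and>
     (\<forall>(f, g, c, c') \<in> {(f12, g12, c1, c2), (f13, g13, c1, c3), (f24, g24, c2, c4), (f34, g34, c3, c4)}.
        square C c f g c' \<and> (g \<in> W \<longleftrightarrow> Qa f \<in> W)) \<and>
     (\<forall>c\<in>{c1, c2, c3, c4}.
        \<exists>w\<in>W. w \<in> Hom C (Qo (Dom C c)) (Cod C c) \<and> w \<cdot>\<^bsub>C\<^esub> \<eta> (Dom C c) = c)"

text \<open>The morphism of maps \<open>(c, c') : f \<rightarrow> g\<close> factors through the morphism of maps
  \<open>(\<eta> (Dom f), \<eta> (Cod f)) : f \<rightarrow> Qa f\<close>.\<close>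

definition factors_through_eta ::
  "('o, 'a) cat \<Rightarrow> ('a \<Rightarrow> 'a) \<Rightarrow> ('o \<Rightarrow> 'a) \<Rightarrow> 'a \<Rightarrow> 'a \<Rightarrow> 'a \<Rightarrow> 'a \<Rightarrow> bool" where
  "factors_through_eta C Qa \<eta> f g c c' \<longleftrightarrow>
     (\<exists>u u'. square C u (Qa f) g u' \<and>
        u \<cdot>\<^bsub>C\<^esub> \<eta> (Dom C f) = c \<and> u' \<cdot>\<^bsub>C\<^esub> \<eta> (Cod C f) = c')"

end

theory Submission
  imports Defs
begin

text \<open>A fibration between objects at which \<open>\<eta>\<close> is a weak equivalence is a \<open>Q\<close>-fibration, since
  localizing a lifting problem changes its right map only up to weak equivalence and turns the left
  map into a weak equivalence. Factoring \<open>Qf = p \<cdot> j\<close> and pulling \<open>p\<close> back along \<open>\<eta>\<close> hence gives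
  a \<open>Q\<close>-fibration over the codomain of \<open>f\<close>, and by (e) the comparison map \<open>k\<close> from the domain of
  \<open>f\<close> is a \<open>Q\<close>-equivalence; this yields the missing factorization. The square of \<open>f\<close> is a homotopy
  pullback iff \<open>k\<close> is a weak equivalence. In that case a fibration \<open>f\<close> is a retract of a
  \<open>Q\<close>-fibration; conversely, if \<open>f\<close> is a \<open>Q\<close>-fibration, then \<open>k\<close> is a \<open>Q\<close>-equivalence between
  \<open>Q\<close>-fibrations over the same object, hence has a homotopy inverse.\<close>

section \<open>Squares, pullbacks and lifting\<close>

text \<open>Fibrations, trivial fibrations and \<open>Q\<close>-fibrations all turn out to be
  classes of this form, so stability under base change, composition and retracts can be proved once
  for all of them.\<close>

definition rlp :: "('o, 'a) cat \<Rightarrow> 'a set \<Rightarrow> 'a set" where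
  "rlp C S = {p \<in> Arr C. \<forall>i\<in>S. has_lifting C i p}"

lemma square_sym: "square C t l r b \<longleftrightarrow> square C l t b r"
  unfolding square_def by auto

lemma is_pullback_sym:
  assumes "is_pullback C t l r b"
  shows "is_pullback C l t b r"
proof -
  have sq: "square C t l r b" using assms unfolding is_pullback_def by blast
  have "\<exists>!h. h \<in> Hom C (Dom C y) (Dom C l) \<and> Comp C l h = y \<and> Comp C t h = x"
    if "square C y x b r" for y x
  proof -
    have xy: "square C x y r b" using that square_sym by metis
    then have "\<exists>!h. h \<in> Hom C (Dom C x) (Dom C t) \<and> Comp C t h = x \<and> Comp C l h = y"
      using assms unfolding is_pullback_def by blast
    moreover have "Dom C x = Dom C y" "Dom C t = Dom C l"
      using sq xy unfolding square_def by auto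
    ultimately show ?thesis by (simp only: conj_commute)
  qed
  then show ?thesis using sq square_sym unfolding is_pullback_def by metis
qed

lemma squareD:
  assumes "square C t l r b"
  shows "t \<in> Arr C" "l \<in> Arr C" "r \<in> Arr C" "b \<in> Arr C"
    "Dom C t = Dom C l" "Cod C t = Dom C r" "Cod C l = Dom C b" "Cod C r = Cod C b"
    "Comp C r t = Comp C b l"
  using assms unfolding square_def by auto

section \<open>Opposite categories and the duality of pullbacks and pushouts\<close>

lemma op_cat_simps [simp]:
  "Obj (op_cat C) = Obj C" "Arr (op_cat C) = Arr C" "Dom (op_cat C) = Cod C"
  "Cod (op_cat C) = Dom C" "Ident (op_cat C) = Ident C" "Comp (op_cat C) g f = Comp C f g"
  "Hom (op_cat C) X Y = Hom C Y X"
  unfolding op_cat_def Hom_def by auto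

text \<open>Reversing all arrows exchanges the upper left and the lower right corner, so
  \<open>r\<close> and \<open>b\<close> become the two maps that leave the initial corner.\<close>

lemma square_op_cat: "square (op_cat C) t l r b \<longleftrightarrow> square C r b t l"
  unfolding square_def by auto

lemma is_pullback_op_cat: "is_pullback (op_cat C) t l r b \<longleftrightarrow> is_pushout C r b t l"
  unfolding is_pullback_def is_pushout_def square_op_cat by simp

context category
begin

abbreviation comp (infixr "\<bullet>" 70) where "g \<bullet> f \<equiv> Comp C g f"

lemma category_op_cat: "category (op_cat C)"
  by unfold_locales
    (auto simp: Dom_closed Cod_closed Ident_in_Hom Ident_left Ident_right Comp_assoc
      intro: Comp_in_Hom)

lemma comp_simps [simp]:
  assumes "f \<in> Arr C" "g \<in> Arr C" "Cod C f = Dom C g"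
  shows "g \<bullet> f \<in> Arr C" "Dom C (g \<bullet> f) = Dom C f" "Cod C (g \<bullet> f) = Cod C g"
  using Comp_in_Hom[of f "Dom C f" "Cod C f" g "Cod C g"] assms by (auto simp: Hom_def)

lemma comp_assoc [simp]:
  assumes "f \<in> Arr C" "g \<in> Arr C" "h \<in> Arr C" "Cod C f = Dom C g" "Cod C g = Dom C h"
  shows "(h \<bullet> g) \<bullet> f = h \<bullet> g \<bullet> f"
  using Comp_assoc[of f "Dom C f" "Cod C f" g "Cod C g" h "Cod C h"] assms
  by (auto simp: Hom_def)

text \<open>Simplification nests composites to the right, which hides the factor
  \<open>g \<bullet> f\<close> in \<open>g \<bullet> f \<bullet> x\<close>; this form allows
  rewriting by a known composite in that position.\<close>

lemma comp_reassoc: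
  assumes "g \<bullet> f = k" "f \<in> Arr C" "g \<in> Arr C" "x \<in> Arr C" "Cod C f = Dom C g" "Cod C x = Dom C f"
  shows "g \<bullet> f \<bullet> x = k \<bullet> x"
  using assms comp_assoc[of x f g] by simp

lemma ident_simps [simp]:
  assumes "X \<in> Obj C"
  shows "Ident C X \<in> Arr C" "Dom C (Ident C X) = X" "Cod C (Ident C X) = X"
  using Ident_in_Hom[OF assms] by (auto simp: Hom_def)

lemma comp_ident [simp]:
  assumes "f \<in> Arr C"
  shows "Dom C f = X \<Longrightarrow> f \<bullet> Ident C X = f" "Cod C f = X \<Longrightarrow> Ident C X \<bullet> f = f"
  using assms Ident_left Ident_right by (auto simp: Hom_def)

lemmas dom_cod_obj [simp] = Dom_closed Cod_closed

lemma pullback_lift: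
  assumes "is_pullback C t l r b" "square C x y r b"
  obtains h where "h \<in> Arr C" "Dom C h = Dom C x" "Cod C h = Dom C t" "t \<bullet> h = x" "l \<bullet> h = y"
  using assms unfolding is_pullback_def Hom_def by blast

lemma pullback_unique:
  assumes "is_pullback C t l r b" "h \<in> Arr C" "h' \<in> Arr C" "Dom C h = Dom C h'"
    "Cod C h = Dom C t" "Cod C h' = Dom C t" "t \<bullet> h = t \<bullet> h'" "l \<bullet> h = l \<bullet> h'"
  shows "h = h'"
proof -
  have sq: "square C t l r b" using assms(1) unfolding is_pullback_def by blast
  note sq_simps = squareD[OF sq]
  have "r \<bullet> t \<bullet> h = b \<bullet> l \<bullet> h"
    using assms(2-6) sq_simps by (simp add: comp_reassoc[OF sq_simps(9)])
  then have "square C (t \<bullet> h) (l \<bullet> h) r b"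
    using assms sq_simps by (auto simp: square_def)
  then have "\<exists>!u. u \<in> Hom C (Dom C (t \<bullet> h)) (Dom C t) \<and> t \<bullet> u = t \<bullet> h \<and> l \<bullet> u = l \<bullet> h"
    using assms(1) unfolding is_pullback_def by blast
  moreover have "Dom C (t \<bullet> h) = Dom C h" using assms sq_simps by simp
  ultimately show ?thesis using assms unfolding Hom_def by (metis (mono_tags, lifting) mem_Collect_eq)
qed

lemma pushout_desc:
  assumes "is_pushout C t l r b" "square C t l x y"
  obtains h where "h \<in> Arr C" "Dom C h = Cod C r" "Cod C h = Cod C x" "h \<bullet> r = x" "h \<bullet> b = y"
  using assms unfolding is_pushout_def Hom_def by blast

lemma pushout_unique:
  assumes "is_pushout C t l r b" "h \<in> Arr C" "h' \<in> Arr C" "Cod C h = Cod C h'"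
    "Dom C h = Cod C r" "Dom C h' = Cod C r" "h \<bullet> r = h' \<bullet> r" "h \<bullet> b = h' \<bullet> b"
  shows "h = h'"
  using category.pullback_unique[OF category_op_cat, of r b t l h h'] assms
  by (simp add: is_pullback_op_cat)

lemma has_liftingE:
  assumes "has_lifting C i p" "square C t i p b"
  obtains h where "h \<in> Arr C" "Dom C h = Cod C i" "Cod C h = Dom C p" "h \<bullet> i = t" "p \<bullet> h = b"
  using assms unfolding has_lifting_def Hom_def by blast

lemma has_liftingI:
  assumes "\<And>t b. square C t i p b \<Longrightarrow>
    \<exists>h. h \<in> Arr C \<and> Dom C h = Cod C i \<and> Cod C h = Dom C p \<and> h \<bullet> i = t \<and> p \<bullet> h = b"
  shows "has_lifting C i p"
  using assms unfolding has_lifting_def Hom_def by blast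

lemma squareI:
  assumes "t \<in> Arr C" "l \<in> Arr C" "r \<in> Arr C" "b \<in> Arr C"
    "Dom C t = Dom C l" "Cod C t = Dom C r" "Cod C l = Dom C b" "Cod C r = Cod C b"
    "r \<bullet> t = b \<bullet> l"
  shows "square C t l r b"
  using assms unfolding square_def by auto

section \<open>Stability of lifting properties\<close>

lemma has_lifting_pullback:
  assumes pb: "is_pullback C t l r b" and lift: "has_lifting C i r"
  shows "has_lifting C i l"
proof (rule has_liftingI)
  fix x y assume xy: "square C x i l y"
  have sq: "square C t l r b" using pb unfolding is_pullback_def by blast
  note s = squareD[OF sq] squareD[OF xy]
  have "r \<bullet> t \<bullet> x = (b \<bullet> y) \<bullet> i"
    using s by (simp add: comp_reassoc[OF squareD(9)[OF sq]])
  then have "square C (t \<bullet> x) i r (b \<bullet> y)" using s by (intro squareI) simp_all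
  then obtain h where h: "h \<in> Arr C" "Dom C h = Cod C i" "Cod C h = Dom C r"
    "h \<bullet> i = t \<bullet> x" "r \<bullet> h = b \<bullet> y" by (rule has_liftingE[OF lift])
  \<comment> \<open>The universal property turns the lift \<open>h\<close> against \<open>r\<close>
    into a candidate \<open>u\<close> against \<open>l\<close>; its upper triangle then follows by
    uniqueness.\<close>
  have "square C h y r b" using s h by (intro squareI) simp_all
  then obtain u where u: "u \<in> Arr C" "Dom C u = Dom C h" "Cod C u = Dom C t" "t \<bullet> u = h" "l \<bullet> u = y"
    by (rule pullback_lift[OF pb])
  have "t \<bullet> u \<bullet> i = t \<bullet> x" "l \<bullet> u \<bullet> i = l \<bullet> x"
    using s h u by (simp_all add: comp_reassoc[OF u(4)] comp_reassoc[OF u(5)])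
  then have "u \<bullet> i = x" by (rule pullback_unique[OF pb, rotated -2]) (use s h u in simp_all)
  then show "\<exists>h. h \<in> Arr C \<and> Dom C h = Cod C i \<and> Cod C h = Dom C l \<and> h \<bullet> i = x \<and> l \<bullet> h = y"
    using s h u by (intro exI[of _ u]) simp
qed

lemma has_lifting_op_cat: "has_lifting (op_cat C) p i \<longleftrightarrow> has_lifting C i p"
  unfolding has_lifting_def square_op_cat square_sym[of C i] by (auto simp: square_sym[of C _ i])

lemma has_lifting_pushout:
  assumes "is_pushout C t l r b" "has_lifting C t p"
  shows "has_lifting C b p"
  using category.has_lifting_pullback[OF category_op_cat, of r b t l p] assms
  by (simp add: is_pullback_op_cat has_lifting_op_cat)

text \<open>Lift against \<open>q\<close> first; the result is the bottom map of a lifting problem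
  for \<open>p\<close>.\<close>

lemma has_lifting_comp:
  assumes pq: "p \<in> Arr C" "q \<in> Arr C" "Cod C p = Dom C q"
    and lift: "has_lifting C i p" "has_lifting C i q"
  shows "has_lifting C i (q \<bullet> p)"
proof (rule has_liftingI)
  fix x y assume xy: "square C x i (q \<bullet> p) y"
  note s = squareD[OF xy] pq
  have "square C (p \<bullet> x) i q y" using s by (intro squareI) simp_all
  then obtain h where h: "h \<in> Arr C" "Dom C h = Cod C i" "Cod C h = Dom C q"
    "h \<bullet> i = p \<bullet> x" "q \<bullet> h = y" by (rule has_liftingE[OF lift(2)])
  have "square C x i p h" using s h by (intro squareI) simp_all
  then obtain u where u: "u \<in> Arr C" "Dom C u = Cod C i" "Cod C u = Dom C p"
    "u \<bullet> i = x" "p \<bullet> u = h" by (rule has_liftingE[OF lift(1)])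
  then show "\<exists>h. h \<in> Arr C \<and> Dom C h = Cod C i \<and> Cod C h = Dom C (q \<bullet> p) \<and> h \<bullet> i = x \<and>
      (q \<bullet> p) \<bullet> h = y"
    using s h by (intro exI[of _ u]) simp
qed

text \<open>Push the problem forward along \<open>(a, b)\<close>, lift against \<open>g\<close> and
  return along \<open>c\<close>.\<close>

lemma has_lifting_retract:
  assumes ret: "is_retract_of C f g" and lift: "has_lifting C i g"
  shows "has_lifting C i f"
proof (rule has_liftingI)
  fix x y assume xy: "square C x i f y"
  obtain a b c d where sq: "square C a f g b" "square C c g f d"
    and id: "c \<bullet> a = Ident C (Dom C f)" "d \<bullet> b = Ident C (Cod C f)"
    using ret unfolding is_retract_of_def by blast
  note s = squareD[OF xy] squareD[OF sq(1)] squareD[OF sq(2)]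
  have "g \<bullet> a \<bullet> x = (b \<bullet> y) \<bullet> i"
    using s by (simp add: comp_reassoc[OF squareD(9)[OF sq(1)]])
  then have "square C (a \<bullet> x) i g (b \<bullet> y)" using s by (intro squareI) simp_all
  then obtain h where h: "h \<in> Arr C" "Dom C h = Cod C i" "Cod C h = Dom C g"
    "h \<bullet> i = a \<bullet> x" "g \<bullet> h = b \<bullet> y" by (rule has_liftingE[OF lift])
  have "(c \<bullet> h) \<bullet> i = x" using s h by (simp add: comp_reassoc[OF id(1)])
  moreover have "f \<bullet> c \<bullet> h = y"
    using s h by (simp add: comp_reassoc[OF squareD(9)[OF sq(2)]] comp_reassoc[OF id(2)])
  ultimately show "\<exists>h. h \<in> Arr C \<and> Dom C h = Cod C i \<and> Cod C h = Dom C f \<and> h \<bullet> i = x \<and> f \<bullet> h = y"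
    using s h by (intro exI[of _ "c \<bullet> h"]) simp
qed

lemma rlp_subset: "rlp C S \<subseteq> Arr C"
  by (auto simp: rlp_def)

lemma rlp_antimono: "S \<subseteq> T \<Longrightarrow> rlp C T \<subseteq> rlp C S"
  by (auto simp: rlp_def)

lemma rlp_pullback:
  "is_pullback C t l r b \<Longrightarrow> r \<in> rlp C S \<Longrightarrow> l \<in> rlp C S"
  using has_lifting_pullback[of t l r b] squareD(2)[of C t l r b]
  unfolding rlp_def is_pullback_def[of C t l r b] by blast

lemma rlp_comp:
  "p \<in> rlp C S \<Longrightarrow> q \<in> rlp C S \<Longrightarrow> Cod C p = Dom C q \<Longrightarrow> q \<bullet> p \<in> rlp C S"
  by (auto simp: rlp_def intro: has_lifting_comp)

lemma rlp_retracts: "closed_under_retracts C (rlp C S)"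
proof -
  have "f \<in> Arr C" if "is_retract_of C f g" for f g
    using that unfolding is_retract_of_def square_def by auto
  then show ?thesis
    using has_lifting_retract unfolding closed_under_retracts_def rlp_def by blast
qed

text \<open>The retract argument: a lift in the square with an identity on top and \<open>p\<close>
  at the bottom splits \<open>p \<bullet> i\<close> off from \<open>p\<close>, with identities on
  the codomains.\<close>

lemma retract_of_right_factor:
  assumes ip: "i \<in> Arr C" "p \<in> Arr C" "Cod C i = Dom C p"
    and lift: "has_lifting C i (p \<bullet> i)"
  shows "is_retract_of C (p \<bullet> i) p"
proof -
  have "square C (Ident C (Dom C i)) i (p \<bullet> i) p" using ip by (intro squareI) simp_all
  then obtain h where h: "h \<in> Arr C" "Dom C h = Cod C i" "Cod C h = Dom C (p \<bullet> i)"
    "h \<bullet> i = Ident C (Dom C i)" "(p \<bullet> i) \<bullet> h = p" by (rule has_liftingE[OF lift])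
  have "square C i (p \<bullet> i) p (Ident C (Cod C p))" using ip by (intro squareI) simp_all
  moreover have "square C h p (p \<bullet> i) (Ident C (Cod C p))" using ip h by (intro squareI) simp_all
  ultimately show ?thesis using ip h unfolding is_retract_of_def
    by (intro exI[of _ i] exI[of _ "Ident C (Cod C p)"] exI[of _ h]) simp
qed

lemma is_retract_of_op_cat: "is_retract_of (op_cat C) f g \<longleftrightarrow> is_retract_of C f g"
  unfolding is_retract_of_def square_op_cat op_cat_simps
  unfolding square_sym[of C f] square_sym[of C g]
  by blast

lemma retract_of_left_factor:
  assumes "i \<in> Arr C" "p \<in> Arr C" "Cod C i = Dom C p" "has_lifting C (p \<bullet> i) p"
  shows "is_retract_of C (p \<bullet> i) i"
  using category.retract_of_right_factor[OF category_op_cat, of p i] assms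
  by (simp add: is_retract_of_op_cat has_lifting_op_cat)

text \<open>A pullback is the limit of a cospan, so it suffices to realize the shape of a cospan
  inside the index type; being finite, it is small with respect to the infinite cardinal
  \<open>\<kappa>\<close>.\<close>

lemma pullback_exists:
  fixes \<kappa> :: "'i rel"
  assumes "Card_order \<kappa>" "infinite (Field \<kappa>)" "has_limits \<kappa> C"
    and rb: "r \<in> Arr C" "b \<in> Arr C" "Cod C r = Cod C b"
  shows "\<exists>t l. is_pullback C t l r b"
proof -
  have "infinite (UNIV :: 'i set)" using assms(2) by (meson finite_subset subset_UNIV)
  then obtain e :: "nat \<Rightarrow> 'i" where e: "inj e"
    using infinite_countable_subset by blast
  \<comment> \<open>Objects double as their identities; \<open>e 3\<close> and \<open>e 4\<close>
    are the legs from \<open>e 0\<close> and \<open>e 1\<close> to \<open>e 2\<close>. Only an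
    identity can precede a leg, and any other second factor is itself an identity, whence the
    formula for composition.\<close>
  define J :: "('i, 'i) cat" where
    "J = \<lparr>Obj = {e 0, e 1, e 2}, Arr = {e 0, e 1, e 2, e 3, e 4},
          Dom = (\<lambda>u. if u = e 3 then e 0 else if u = e 4 then e 1 else u),
          Cod = (\<lambda>u. if u = e 3 \<or> u = e 4 then e 2 else u),
          Ident = (\<lambda>x. x),
          Comp = (\<lambda>g f. if g = e 3 \<or> g = e 4 then g else f)\<rparr>"
  have ne [simp]: "e m = e n \<longleftrightarrow> m = n" for m n using e by (auto simp: inj_eq)
  have J: "category J"
  proof
    show "Comp J g f \<in> Hom J X Z" if "f \<in> Hom J X Y" "g \<in> Hom J Y Z" for f g X Y Z
      using that by (cases "g = e 3 \<or> g = e 4") (auto simp: J_def Hom_def split: if_splits)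
    show "Comp J (Comp J h g) f = Comp J h (Comp J g f)" for f g h by (simp add: J_def)
  qed (auto simp: J_def Hom_def split: if_splits)
  have "finite (Arr J)" by (simp add: J_def)
  then have small: "(card_of (Arr J), \<kappa>) \<in> ordLess"
    using assms(1,2) finite_ordLess_infinite[OF card_of_Well_order, of \<kappa> "Arr J"]
    by (auto simp: Field_card_of card_order_on_def)
  define Fo where "Fo x = (if x = e 0 then Dom C r else if x = e 1 then Dom C b else Cod C r)" for x
  define Fa where "Fa u = (if u = e 3 then r else if u = e 4 then b else Ident C (Fo u))" for u
  have diag: "is_diagram J C Fo Fa"
    unfolding is_diagram_def using rb
    by (auto simp: J_def Fo_def Fa_def Hom_def)
  obtain X p where lim: "is_limit J C Fo Fa X p"
    using assms(3) J small diag unfolding has_limits_def by blast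
  \<comment> \<open>A cone is a commutative square together with its diagonal
    \<open>q (e 2)\<close>, which the square determines.\<close>
  have cone: "is_cone J C Fo Fa Y q \<longleftrightarrow>
      q (e 0) \<in> Arr C \<and> q (e 1) \<in> Arr C \<and> Y = Dom C (q (e 0)) \<and>
      q (e 2) = r \<bullet> q (e 0) \<and> square C (q (e 0)) (q (e 1)) r b" for Y q
    unfolding is_cone_def using rb
    by (auto simp: J_def Fo_def Fa_def Hom_def square_def)
  have sq: "square C (p (e 0)) (p (e 1)) r b" and p2: "p (e 2) = r \<bullet> p (e 0)"
    and X: "X = Dom C (p (e 0))"
    using lim unfolding is_limit_def cone by auto
  note s = squareD[OF sq]
  have "\<exists>!h. h \<in> Hom C (Dom C x) (Dom C (p (e 0))) \<and> p (e 0) \<bullet> h = x \<and> p (e 1) \<bullet> h = y"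
    if xy: "square C x y r b" for x y
  proof -
    define q where "q j = (if j = e 0 then x else if j = e 1 then y else r \<bullet> x)" for j
    have "is_cone J C Fo Fa (Dom C x) q"
      unfolding cone using xy squareD[OF xy] by (simp add: q_def)
    then have "\<exists>!h. h \<in> Hom C (Dom C x) X \<and> (\<forall>j\<in>Obj J. p j \<bullet> h = q j)"
      using lim unfolding is_limit_def by blast
    moreover have "(\<forall>j\<in>Obj J. p j \<bullet> h = q j) \<longleftrightarrow> p (e 0) \<bullet> h = x \<and> p (e 1) \<bullet> h = y"
      if "h \<in> Hom C (Dom C x) X" for h
      using that s rb X p2 by (auto simp: J_def q_def Hom_def comp_reassoc[OF s(9)])
    ultimately show ?thesis unfolding X by (metis (no_types, lifting))
  qed
  then show ?thesis using sq unfolding is_pullback_def by blast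
qed

end


section \<open>Model categories\<close>

context category
begin

section \<open>Factorizations and the recognition of classes by lifting\<close>

lemma has_factorizationsE:
  assumes "has_factorizations C L R" "L \<subseteq> Arr C" "R \<subseteq> Arr C" "f \<in> Arr C"
  obtains i p where "i \<in> L" "p \<in> R" "Cod C i = Dom C p" "p \<bullet> i = f"
    "i \<in> Arr C" "p \<in> Arr C" "Dom C i = Dom C f" "Cod C p = Cod C f"
proof -
  obtain i p where ip: "i \<in> L" "p \<in> R" "Cod C i = Dom C p" "p \<bullet> i = f"
    using assms(1,4) unfolding has_factorizations_def by blast
  moreover have "i \<in> Arr C" "p \<in> Arr C" using ip assms(2,3) by auto
  ultimately show thesis using that comp_simps(2,3)[of i p] by auto
qed

lemma two_out_of_threeD:
  assumes "two_out_of_three C S" "f \<in> Arr C" "g \<in> Arr C" "Cod C f = Dom C g"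
  shows "f \<in> S \<Longrightarrow> g \<in> S \<Longrightarrow> g \<bullet> f \<in> S"
    "f \<in> S \<Longrightarrow> g \<bullet> f \<in> S \<Longrightarrow> g \<in> S"
    "g \<in> S \<Longrightarrow> g \<bullet> f \<in> S \<Longrightarrow> f \<in> S"
  using assms unfolding two_out_of_three_def by blast+

text \<open>By the retract argument, factorizations and closure under retracts force the right class
  to contain every map with the lifting property.\<close>

lemma rlp_eq:
  assumes "L \<subseteq> Arr C" "R \<subseteq> Arr C" "has_factorizations C L R" "closed_under_retracts C R"
    and "\<And>i p. i \<in> L \<Longrightarrow> p \<in> R \<Longrightarrow> has_lifting C i p"
  shows "rlp C L = R"
proof
  show "rlp C L \<subseteq> R"
  proof
    fix f assume f: "f \<in> rlp C L"
    then have "f \<in> Arr C" by (simp add: rlp_def)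
    then obtain i p where ip: "i \<in> L" "p \<in> R" "Cod C i = Dom C p" "p \<bullet> i = f"
      by (rule has_factorizationsE[OF assms(3,1,2)])
    have "has_lifting C i (p \<bullet> i)" using f ip by (simp add: rlp_def)
    then have "is_retract_of C f p"
      using retract_of_right_factor[of i p] ip assms(1,2) by auto
    then show "f \<in> R" using ip(2) assms(4) unfolding closed_under_retracts_def by blast
  qed
  show "R \<subseteq> rlp C L" using assms by (auto simp: rlp_def)
qed

text \<open>Dual retract argument, used below for the stability of cofibrations that are
  \<open>Q\<close>-equivalences under cobase change.\<close>

lemma left_class_if_lifting:
  assumes "L \<subseteq> Arr C" "R \<subseteq> Arr C" "has_factorizations C L R" "closed_under_retracts C L"
    and f: "f \<in> Arr C" "\<And>p. p \<in> R \<Longrightarrow> has_lifting C f p"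
  shows "f \<in> L"
proof -
  obtain i p where ip: "i \<in> L" "p \<in> R" "Cod C i = Dom C p" "p \<bullet> i = f"
    by (rule has_factorizationsE[OF assms(3,1,2) f(1)])
  have "has_lifting C (p \<bullet> i) p" using f ip by simp
  then have "is_retract_of C f i"
    using retract_of_left_factor[of i p] ip assms(1,2) by auto
  then show ?thesis using ip(1) assms(4) unfolding closed_under_retracts_def by blast
qed

end

context model_category
begin

lemma arrI [intro]: "f \<in> W \<Longrightarrow> f \<in> Arr C" "f \<in> Cof \<Longrightarrow> f \<in> Arr C" "f \<in> Fib \<Longrightarrow> f \<in> Arr C"
  using W_subset Cof_subset Fib_subset by auto

lemmas W_comp = two_out_of_threeD(1)[OF W_two_out_of_three]
  and W_cancel_right = two_out_of_threeD(2)[OF W_two_out_of_three]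
  and W_cancel_left = two_out_of_threeD(3)[OF W_two_out_of_three]

lemmas factorE_trivial_Fib = has_factorizationsE[OF factorization_Cof_trivial_Fib Cof_subset
      le_infI1[OF Fib_subset]]
  and factorE_trivial_Cof = has_factorizationsE[OF factorization_trivial_Cof_Fib
      le_infI1[OF Cof_subset] Fib_subset]

lemma pushout_exists:
  assumes "t \<in> Arr C" "l \<in> Arr C" "Dom C t = Dom C l"
  shows "\<exists>r b. is_pushout C t l r b"
  using category.pullback_exists[OF category_op_cat Card_order_kappa infinite_kappa, of t l]
    colimits assms
  by (auto simp: has_colimits_def is_pullback_op_cat)

lemma rlp_Cof: "rlp C Cof = Fib \<inter> W"
proof (rule rlp_eq)
  show "closed_under_retracts C (Fib \<inter> W)"
    using Fib_retracts W_retracts unfolding closed_under_retracts_def by blast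
qed (use Cof_subset Fib_subset factorization_Cof_trivial_Fib lifting_Cof_trivial_Fib in auto)

lemma rlp_trivial_Cof: "rlp C (Cof \<inter> W) = Fib"
  by (rule rlp_eq)
    (use Cof_subset Fib_subset Fib_retracts factorization_trivial_Cof_Fib
      lifting_trivial_Cof_Fib in auto)

text \<open>Factor the identity with a trivial fibration \<open>p\<close> as second map. Since
  \<open>Ident C X \<bullet> p = p\<close>, 2-out-of-3 applies to \<open>p\<close> followed by the
  identity.\<close>

lemma Ident_in_W:
  assumes "X \<in> Obj C"
  shows "Ident C X \<in> W"
proof -
  have "Ident C X \<in> Arr C" using assms by simp
  then obtain i p where ip: "i \<in> Cof" "p \<in> Fib \<inter> W" "Cod C i = Dom C p" "p \<bullet> i = Ident C X"
    by (rule factorE_trivial_Fib)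
  have arr: "i \<in> Arr C" "p \<in> Arr C" using ip by auto
  then have cod: "Cod C p = X" using ip(3,4) assms comp_simps(3)[of i p] by simp
  then have "Ident C X \<bullet> p = p" using arr by simp
  then show ?thesis using W_cancel_right[of p "Ident C X"] ip arr cod assms by simp
qed

end

section \<open>Homotopy localizations\<close>

locale square_homotopy_localization = homotopy_localization \<kappa> C W Cof Fib Qo Qa \<eta>
  for \<kappa> :: "'i rel" and C :: "('o, 'a) cat" and W Cof Fib :: "'a set"
    and Qo :: "'o \<Rightarrow> 'o" and Qa :: "'a \<Rightarrow> 'a" and \<eta> :: "'o \<Rightarrow> 'a" +
  assumes right_proper_W: "right_proper C W Fib"
    and eta_natural: "f \<in> Arr C \<Longrightarrow> \<eta> (Cod C f) \<bullet> f = Qa f \<bullet> \<eta> (Dom C f)"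
    and Qeq_retracts: "closed_under_retracts C (Q_equivalences C W Qa)"
    and Qeq_two_out_of_three: "two_out_of_three C (Q_equivalences C W Qa)"
    and cube_exists: "square C f12 f13 f24 f34 \<Longrightarrow>
      \<exists>g12 g13 g24 g34 c1 c2 c3 c4.
        localization_cube C W Qo Qa \<eta> f12 f13 f24 f34 g12 g13 g24 g34 c1 c2 c3 c4"
    and Qeq_pullback: "is_pullback C t g f h \<Longrightarrow> h \<in> Q_fibrations C W Cof Qa \<Longrightarrow>
      f \<in> Q_equivalences C W Qa \<Longrightarrow> g \<in> Q_equivalences C W Qa"
begin

section \<open>Comparison of the localized classes with the original ones\<close>

abbreviation "Qeq \<equiv> Q_equivalences C W Qa"
abbreviation "Qfib \<equiv> Q_fibrations C W Cof Qa"

lemmas Qeq_comp = two_out_of_threeD(1)[OF Qeq_two_out_of_three]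
  and Qeq_cancel_right = two_out_of_threeD(2)[OF Qeq_two_out_of_three]
  and Qeq_cancel_left = two_out_of_threeD(3)[OF Qeq_two_out_of_three]

lemma W_subset_Qeq: "W \<subseteq> Qeq"
  using W_subset Q_preserves_W by (auto simp: Q_equivalences_def)

lemma Qeq_arr: "f \<in> Qeq \<Longrightarrow> f \<in> Arr C"
  by (simp add: Q_equivalences_def)

lemma Qfib_rlp: "Qfib = rlp C (Cof \<inter> Qeq)"
  by (simp add: Q_fibrations_def Q_cofibrations_def rlp_def)

lemma Qfib_subset_Fib: "Qfib \<subseteq> Fib"
  unfolding Qfib_rlp rlp_trivial_Cof[symmetric] using W_subset_Qeq by (intro rlp_antimono) auto

text \<open>For the harder inclusion, factor \<open>f\<close> into a cofibration \<open>i\<close>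
  and a trivial fibration \<open>p\<close>. By 2-out-of-3 \<open>i\<close> is a
  \<open>Q\<close>-equivalence, so \<open>f\<close> lifts against \<open>i\<close> and is a retract
  of \<open>p\<close>.\<close>

lemma trivial_Qfib: "Qfib \<inter> Qeq = Fib \<inter> W"
proof
  show "Fib \<inter> W \<subseteq> Qfib \<inter> Qeq"
    using rlp_antimono[of "Cof \<inter> Qeq" Cof] W_subset_Qeq by (auto simp: rlp_Cof Qfib_rlp)
  show "Qfib \<inter> Qeq \<subseteq> Fib \<inter> W"
  proof
    fix f assume f: "f \<in> Qfib \<inter> Qeq"
    then have "f \<in> Arr C" using Qeq_arr by auto
    then obtain i p where ip: "i \<in> Cof" "p \<in> Fib \<inter> W" "Cod C i = Dom C p" "p \<bullet> i = f"
      by (rule factorE_trivial_Fib)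
    have arr: "i \<in> Arr C" "p \<in> Arr C" using ip by auto
    have "i \<in> Qeq" using Qeq_cancel_left[OF arr ip(3)] ip f W_subset_Qeq by auto
    then have "has_lifting C i (p \<bullet> i)" using f ip by (auto simp: Qfib_rlp rlp_def)
    then have "is_retract_of C f p" using retract_of_right_factor[OF arr ip(3)] ip by simp
    then show "f \<in> Fib \<inter> W"
      using ip(2) rlp_retracts[of Cof] unfolding rlp_Cof closed_under_retracts_def by blast
  qed
qed

text \<open>Serves to absorb the second factor whenever a comparison map is factored into a
  cofibration and a trivial fibration.\<close>

lemma Qfib_comp_trivial_Fib:
  assumes "n \<in> Fib \<inter> W" "l \<in> Qfib" "Cod C n = Dom C l"
  shows "l \<bullet> n \<in> Qfib"
proof -
  have "n \<in> Qfib" using assms(1) trivial_Qfib by blast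
  then show ?thesis using assms rlp_comp[of n "Cof \<inter> Qeq" l] by (simp add: Qfib_rlp)
qed

section \<open>Local objects and fibrations between them\<close>

lemma eta_arr [simp]:
  assumes "X \<in> Obj C"
  shows "\<eta> X \<in> Arr C" "Dom C (\<eta> X) = X" "Cod C (\<eta> X) = Qo X"
  using eta_in_Hom[OF assms] by (auto simp: Hom_def)

lemma Qa_arr [simp]:
  assumes "f \<in> Arr C"
  shows "Qa f \<in> Arr C" "Dom C (Qa f) = Qo (Dom C f)" "Cod C (Qa f) = Qo (Cod C f)"
  using Qa_in_Hom[of f "Dom C f" "Cod C f"] assms by (auto simp: Hom_def)

text \<open>The other three maps of the naturality square of \<open>f\<close> are weak equivalences.
  Thus locality of an object, meaning that \<open>\<eta>\<close> is a weak equivalence there, passes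
  along \<open>f\<close>.\<close>

lemma eta_in_W_transfer:
  assumes f: "f \<in> W" and eta: "\<eta> (Dom C f) \<in> W"
  shows "\<eta> (Cod C f) \<in> W"
proof -
  have arr: "f \<in> Arr C" using f by auto
  have "Qa f \<bullet> \<eta> (Dom C f) \<in> W"
    using W_comp[of "\<eta> (Dom C f)" "Qa f"] arr eta Q_preserves_W[OF f] by simp
  then show ?thesis
    using W_cancel_right[of f "\<eta> (Cod C f)"] arr f eta_natural[OF arr] by simp
qed

text \<open>Locality of both ends of \<open>p\<close> makes \<open>c2\<close> and \<open>c4\<close> weak equivalences, so by right properness
  \<open>p\<close> is a homotopy pullback of the right map of the back face of the cube.\<close>

lemma local_fibration_Qfib:
  assumes p: "p \<in> Fib" and dom: "\<eta> (Dom C p) \<in> W" and cod: "\<eta> (Cod C p) \<in> W"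
  shows "p \<in> Qfib"
proof -
  have "has_lifting C i p" if i: "i \<in> Cof" "i \<in> Qeq" for i
  proof (rule has_liftingI)
    fix t b assume sq: "square C t i p b"
    \<comment> \<open>The lifting problem itself is the front face, so \<open>g13\<close> replaces
      \<open>i\<close> and is a weak equivalence because \<open>i\<close> is a
      \<open>Q\<close>-equivalence.\<close>
    obtain g12 g13 g24 g34 c1 c2 c3 c4
      where cube: "localization_cube C W Qo Qa \<eta> t i p b g12 g13 g24 g34 c1 c2 c3 c4"
      using cube_exists[OF sq] by blast
    have back_face: "square C g12 g13 g24 g34"
      and side: "square C c1 t g12 c2" "square C c1 i g13 c3" "square C c2 p g24 c4"
        "square C c3 b g34 c4"
      and g13: "g13 \<in> W"
      using cube i by (auto simp: localization_cube_def Q_equivalences_def)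
    have factors: "\<forall>c\<in>{c1, c2, c3, c4}.
        \<exists>w\<in>W. w \<in> Hom C (Qo (Dom C c)) (Cod C c) \<and> w \<bullet> \<eta> (Dom C c) = c"
      using cube unfolding localization_cube_def by (elim conjE)
    have c_W: "c \<in> W" if "c \<in> {c2, c4}" "\<eta> (Dom C c) \<in> W" for c
    proof -
      have "c \<in> {c1, c2, c3, c4}" using that(1) by auto
      then obtain w where w: "w \<in> W" "w \<in> Hom C (Qo (Dom C c)) (Cod C c)" "w \<bullet> \<eta> (Dom C c) = c"
        using bspec[OF factors] by blast
      have "c \<in> Arr C" using that(1) squareD[OF side(3)] by auto
      then have "w \<bullet> \<eta> (Dom C c) \<in> W"
        using w(1,2) that(2) by (intro W_comp) (simp_all add: Hom_def)
      then show ?thesis unfolding w(3) .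
    qed
    note s = squareD[OF sq] squareD[OF back_face] squareD[OF side(1)] squareD[OF side(2)]
      squareD[OF side(3)] squareD[OF side(4)]
    have c2: "c2 \<in> W" and c4: "c4 \<in> W"
      using c_W[of c2] c_W[of c4] dom cod squareD(5,7)[OF side(3)] by simp_all

    \<comment> \<open>The right map of the back face becomes a fibration \<open>q\<close> and the
      left one a trivial fibration \<open>v\<close>; the lift \<open>u\<close> is the new top map
      from the domain of \<open>v\<close> to that of \<open>q\<close>.\<close>
    obtain j q where jq: "j \<in> Cof \<inter> W" "q \<in> Fib" "Cod C j = Dom C q" "q \<bullet> j = g24"
      and jq': "j \<in> Arr C" "q \<in> Arr C" "Dom C j = Dom C g24" "Cod C q = Cod C g24"
      by (rule factorE_trivial_Cof[OF s(12)])
    obtain k v where kv: "k \<in> Cof \<inter> W" "v \<in> Fib" "Cod C k = Dom C v" "v \<bullet> k = g13"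
      and kv': "k \<in> Arr C" "v \<in> Arr C" "Dom C k = Dom C g13" "Cod C v = Cod C g13"
      by (rule factorE_trivial_Cof[OF s(11)])
    have v: "v \<in> W" using W_cancel_right[of k v] kv kv' g13 by auto
    have "square C (j \<bullet> g12) k q (g34 \<bullet> v)"
      by (rule squareI) (use s jq kv jq' kv' in \<open>simp_all add: comp_reassoc[OF jq(4)]\<close>)
    then obtain u where u: "u \<in> Arr C" "Dom C u = Cod C k" "Cod C u = Dom C q"
      "u \<bullet> k = j \<bullet> g12" "q \<bullet> u = g34 \<bullet> v"
      by (rule has_liftingE[OF lifting_trivial_Cof_Fib[OF kv(1) jq(2)]])
    \<comment> \<open>As \<open>v\<close> is a trivial fibration, the cofibration \<open>i\<close>
      lifts against it. Then \<open>u \<bullet> h\<close> solves the lifting problem transported to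
      the back face.\<close>
    have "square C (k \<bullet> c1) i v c3"
      by (rule squareI) (use s kv kv' in \<open>simp_all add: comp_reassoc[OF kv(4)]\<close>)
    then obtain h where h: "h \<in> Arr C" "Dom C h = Cod C i" "Cod C h = Dom C v"
      "h \<bullet> i = k \<bullet> c1" "v \<bullet> h = c3"
      using has_liftingE[OF lifting_Cof_trivial_Fib[of i v]] i kv v by blast

    \<comment> \<open>Pulling \<open>q\<close> back along \<open>c4\<close> returns to the base of
      \<open>p\<close>. Right properness makes \<open>t2\<close>, and then the comparison map
      \<open>x\<close> from \<open>p\<close> to \<open>l2\<close>, a weak equivalence.\<close>
    obtain t2 l2 where pb: "is_pullback C t2 l2 q c4"
      using pullback_exists[OF Card_order_kappa infinite_kappa limits, of q c4] s jq' by auto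
    have sq2: "square C t2 l2 q c4" using pb unfolding is_pullback_def by blast
    note s2 = squareD[OF sq2]
    have t2: "t2 \<in> W"
      using right_proper_W is_pullback_sym[OF pb] jq(2) c4 unfolding right_proper_def by blast
    have "square C (j \<bullet> c2) p q c4"
      by (rule squareI) (use s jq jq' in \<open>simp_all add: comp_reassoc[OF jq(4)]\<close>)
    then obtain x where x: "x \<in> Arr C" "Dom C x = Dom C (j \<bullet> c2)" "Cod C x = Dom C t2"
      "t2 \<bullet> x = j \<bullet> c2" "l2 \<bullet> x = p" by (rule pullback_lift[OF pb])
    have x_dom: "Dom C x = Dom C p" using x s jq jq' by simp
    have "j \<bullet> c2 \<in> W" using W_comp[of c2 j] c2 jq jq' s by simp
    then have x_W: "x \<in> W" using W_cancel_left[of x t2] x t2 s2 by simp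
    have "square C (u \<bullet> h) b q c4"
      by (rule squareI)
        (use s u h kv kv' jq' in \<open>simp_all add: comp_reassoc[OF u(5)] comp_reassoc[OF h(5)]\<close>)
    then obtain y where y: "y \<in> Arr C" "Dom C y = Dom C (u \<bullet> h)" "Cod C y = Dom C t2"
      "t2 \<bullet> y = u \<bullet> h" "l2 \<bullet> y = b" by (rule pullback_lift[OF pb])
    have y_dom: "Dom C y = Cod C i" using y u h kv by simp
    have "t2 \<bullet> y \<bullet> i = t2 \<bullet> x \<bullet> t"
      using x y x_dom y_dom s s2 u h kv kv' jq jq'
      by (simp add: comp_reassoc[OF x(4)] comp_reassoc[OF y(4)] comp_reassoc[OF u(4)])
    moreover have "l2 \<bullet> y \<bullet> i = l2 \<bullet> x \<bullet> t"
      using x y x_dom y_dom s s2 by (simp add: comp_reassoc[OF x(5)] comp_reassoc[OF y(5)])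
    ultimately have yi: "y \<bullet> i = x \<bullet> t"
      by (rule pullback_unique[OF pb, rotated -2]) (use x y x_dom y_dom s in simp_all)

    \<comment> \<open>So far \<open>y\<close> solves the problem only after composing with
      \<open>x\<close>. It is lifted through the trivial fibration \<open>n\<close>, and the trivial
      cofibration \<open>m\<close> admits a retraction \<open>r\<close> over the base because
      \<open>p\<close> is a fibration.\<close>
    obtain m n where mn: "m \<in> Cof" "n \<in> Fib \<inter> W" "Cod C m = Dom C n" "n \<bullet> m = x"
      and mn': "m \<in> Arr C" "n \<in> Arr C" "Dom C m = Dom C x" "Cod C n = Cod C x"
      by (rule factorE_trivial_Fib[OF x(1)])
    have m: "m \<in> W" using W_cancel_left[of m n] mn mn' x_W by auto
    have "square C (m \<bullet> t) i n y"
      by (rule squareI) (use squareD(1-6)[OF sq] mn mn' x(1,3) x_dom y(1,3) y_dom yi in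
        \<open>simp_all add: comp_reassoc[OF mn(4)]\<close>)
    then obtain z where z: "z \<in> Arr C" "Dom C z = Cod C i" "Cod C z = Dom C n"
      "z \<bullet> i = m \<bullet> t" "n \<bullet> z = y"
      by (rule has_liftingE[OF lifting_Cof_trivial_Fib[OF i(1) mn(2)]])
    have m_lift: "has_lifting C m p" using lifting_trivial_Cof_Fib[of m p] mn(1) m p by blast
    have "square C (Ident C (Dom C p)) m p (l2 \<bullet> n)"
      by (rule squareI) (use squareD(2,7)[OF side(3)] s2(2,5,7) mn mn' x(1,3,5) x_dom in
        simp_all)
    then obtain r where r: "r \<in> Arr C" "Dom C r = Cod C m" "Cod C r = Dom C p"
      "r \<bullet> m = Ident C (Dom C p)" "p \<bullet> r = l2 \<bullet> n"
      by (rule has_liftingE[OF m_lift])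
    have "(r \<bullet> z) \<bullet> i = t"
      using squareD(1-6)[OF sq] r z mn mn' x_dom by (simp add: comp_reassoc[OF r(4)])
    moreover have "p \<bullet> r \<bullet> z = b"
      using squareD(3)[OF sq] s2(2,5) r z mn mn' x(3) y(5) by (simp add: comp_reassoc[OF r(5)])
    ultimately show "\<exists>h. h \<in> Arr C \<and> Dom C h = Cod C i \<and> Cod C h = Dom C p \<and> h \<bullet> i = t \<and> p \<bullet> h = b"
      using r z mn by (intro exI[of _ "r \<bullet> z"]) simp
  qed
  then show ?thesis using p by (auto simp: Qfib_rlp rlp_def)
qed

section \<open>Replacement by a \<open>Q\<close>-fibration and the localized model structure\<close>

lemma Qfib_replacement:
  assumes f: "f \<in> Arr C"
  obtains j p t l k where "j \<in> W" "p \<in> Fib" "Cod C j = Dom C p" "p \<bullet> j = Qa f"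
    "is_pullback C t l p (\<eta> (Cod C f))" "k \<in> Qeq" "Dom C k = Dom C f" "Cod C k = Dom C t"
    "t \<bullet> k = j \<bullet> \<eta> (Dom C f)" "l \<in> Qfib" "l \<bullet> k = f"
proof -
  have "Qa f \<in> Arr C" using f by simp
  then obtain j p where jp: "j \<in> Cof \<inter> W" "p \<in> Fib" "Cod C j = Dom C p" "p \<bullet> j = Qa f"
    and jp': "j \<in> Arr C" "p \<in> Arr C" "Dom C j = Dom C (Qa f)" "Cod C p = Cod C (Qa f)"
    by (rule factorE_trivial_Cof)
  \<comment> \<open>The weak equivalence \<open>j\<close> carries locality from
    \<open>Qo (Dom C f)\<close> to the middle object, so both ends of \<open>p\<close> are
    local.\<close>
  have "\<eta> (Dom C p) \<in> W" using eta_in_W_transfer[of j] eta_Q_in_W jp jp' f by simp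
  then have p: "p \<in> Qfib" using local_fibration_Qfib[OF jp(2)] jp' eta_Q_in_W f by simp
  obtain t l where pb: "is_pullback C t l p (\<eta> (Cod C f))"
    using pullback_exists[OF Card_order_kappa infinite_kappa limits, of p "\<eta> (Cod C f)"] jp' f
    by auto
  have sq: "square C t l p (\<eta> (Cod C f))" using pb unfolding is_pullback_def by blast
  note s = squareD[OF sq]
  have l: "l \<in> Qfib" using rlp_pullback[OF pb] p unfolding Qfib_rlp by blast
  have eta: "\<eta> X \<in> Qeq" if "X \<in> Obj C" for X
    using that Q_eta_in_W by (simp add: Q_equivalences_def)
  \<comment> \<open>\<open>t\<close> is the base change of \<open>\<eta> (Cod C f)\<close> along the
    \<open>Q\<close>-fibration \<open>p\<close>, so (e) applies.\<close>
  have t: "t \<in> Qeq" using Qeq_pullback[OF is_pullback_sym[OF pb] p] eta f by simp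
  have "square C (j \<bullet> \<eta> (Dom C f)) f p (\<eta> (Cod C f))"
    by (rule squareI)
      (use jp jp' f eta_natural[OF f] in \<open>simp_all add: comp_reassoc[OF jp(4)]\<close>)
  then obtain k where k: "k \<in> Arr C" "Dom C k = Dom C (j \<bullet> \<eta> (Dom C f))" "Cod C k = Dom C t"
    "t \<bullet> k = j \<bullet> \<eta> (Dom C f)" "l \<bullet> k = f" by (rule pullback_lift[OF pb])
  have "j \<bullet> \<eta> (Dom C f) \<in> Qeq"
    using Qeq_comp[of "\<eta> (Dom C f)" j] jp jp' f eta W_subset_Qeq by auto
  then have "k \<in> Qeq" using Qeq_cancel_left[of k t] k t s by simp
  moreover have "Dom C k = Dom C f" using k jp' f by simp
  ultimately show thesis using that[of j p t l k] jp pb k l by blast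
qed

text \<open>The \<open>Q\<close>-equivalence \<open>k\<close> of the replacement may fail to be a
  cofibration. Factoring it as \<open>n \<bullet> m\<close> with \<open>n\<close> a trivial
  fibration and moving \<open>n\<close> into the second map repairs this.\<close>

lemma factorization_trivial_Cof_Qfib: "has_factorizations C (Cof \<inter> Qeq) Qfib"
  unfolding has_factorizations_def
proof
  fix f assume f: "f \<in> Arr C"
  obtain p t l k where pb: "is_pullback C t l p (\<eta> (Cod C f))" and
    k: "k \<in> Qeq" "Cod C k = Dom C t" "l \<in> Qfib" "l \<bullet> k = f"
    by (rule Qfib_replacement[OF f]) blast
  have l: "l \<in> Arr C" "Dom C l = Dom C t"
    using pb unfolding is_pullback_def square_def by auto
  obtain m n where mn: "m \<in> Cof" "n \<in> Fib \<inter> W" "Cod C m = Dom C n" "n \<bullet> m = k"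
    and mn': "m \<in> Arr C" "n \<in> Arr C" "Dom C m = Dom C k" "Cod C n = Cod C k"
    by (rule factorE_trivial_Fib[OF Qeq_arr[OF k(1)]])
  have "m \<in> Qeq" using Qeq_cancel_left[of m n] mn mn' k W_subset_Qeq by auto
  moreover have "l \<bullet> n \<in> Qfib"
    using Qfib_comp_trivial_Fib[of n l] mn(2) mn' k(3) k(2) l by simp
  moreover have "Cod C m = Dom C (l \<bullet> n)" "(l \<bullet> n) \<bullet> m = f" using mn mn' l k by simp_all
  ultimately show "\<exists>i\<in>Cof \<inter> Qeq. \<exists>p\<in>Qfib. Cod C i = Dom C p \<and> p \<bullet> i = f"
    using mn(1) by blast
qed

text \<open>Cofibrations and trivial fibrations are the same as before, so one half of the lifting
  and factorization axioms is inherited; in the other half, lifting is the definition of a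
  \<open>Q\<close>-fibration.\<close>

lemma Q_model_category: "model_category \<kappa> C Qeq (Q_cofibrations Cof) Qfib"
  unfolding Q_cofibrations_def
proof
  show "closed_under_retracts C Qfib" unfolding Qfib_rlp by (rule rlp_retracts)
  show "has_factorizations C Cof (Qfib \<inter> Qeq)"
    unfolding trivial_Qfib by (rule factorization_Cof_trivial_Fib)
  show "has_lifting C i p" if "i \<in> Cof" "p \<in> Qfib \<inter> Qeq" for i p
    using that lifting_Cof_trivial_Fib unfolding trivial_Qfib by blast
  show "has_lifting C i p" if "i \<in> Cof \<inter> Qeq" "p \<in> Qfib" for i p
    using that by (auto simp: Qfib_rlp rlp_def)
  show "Qfib \<subseteq> Arr C" unfolding Qfib_rlp by (rule rlp_subset)
qed (use Card_order_kappa infinite_kappa limits colimits Cof_subset Qeq_arr Qeq_two_out_of_three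
  Qeq_retracts Cof_retracts factorization_trivial_Cof_Qfib in auto)

section \<open>The homotopy pullback criterion for \<open>Q\<close>-fibrations\<close>

lemma Qfib_if_homotopy_pullback:
  assumes f: "f \<in> Fib"
    and hp: "is_homotopy_pullback C W Fib (\<eta> (Dom C f)) f (Qa f) (\<eta> (Cod C f))"
  shows "f \<in> Qfib"
proof -
  have arr: "f \<in> Arr C" using f by auto
  obtain j p t l k where jp: "j \<in> W" "p \<in> Fib" "Cod C j = Dom C p" "p \<bullet> j = Qa f"
    and pb: "is_pullback C t l p (\<eta> (Cod C f))"
    and k: "k \<in> W" "k \<in> Hom C (Dom C (\<eta> (Dom C f))) (Dom C t)" "l \<bullet> k = f"
    using hp unfolding is_homotopy_pullback_def by blast
  have jp': "j \<in> Arr C" "p \<in> Arr C" using jp by auto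
  then have jp'': "Dom C j = Qo (Dom C f)" "Cod C p = Qo (Cod C f)"
    using jp arr comp_simps(2,3)[of j p] by simp_all
  \<comment> \<open>The factorization is the one supplied by the homotopy pullback; locality of its
    middle object needs only that \<open>j\<close> is a weak equivalence.\<close>
  have "\<eta> (Dom C p) \<in> W" using eta_in_W_transfer[of j] eta_Q_in_W jp jp' jp'' arr by simp
  then have "p \<in> Qfib" using local_fibration_Qfib[OF jp(2)] jp' jp'' eta_Q_in_W arr by simp
  then have l: "l \<in> Qfib" using rlp_pullback[OF pb] unfolding Qfib_rlp by blast
  have l': "l \<in> Arr C" "Dom C l = Dom C t"
    using pb unfolding is_pullback_def square_def by auto
  have k_arr: "k \<in> Arr C" using k by auto
  obtain m n where mn: "m \<in> Cof" "n \<in> Fib \<inter> W" "Cod C m = Dom C n" "n \<bullet> m = k"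
    and mn': "m \<in> Arr C" "n \<in> Arr C" "Dom C m = Dom C k" "Cod C n = Cod C k"
    by (rule factorE_trivial_Fib[OF k_arr])
  have m: "m \<in> W" using W_cancel_left[of m n] mn mn' k by auto
  have ln: "l \<bullet> n \<in> Qfib"
    using Qfib_comp_trivial_Fib[of n l] mn(2) mn' l k l' by (simp add: Hom_def)
  have eq: "(l \<bullet> n) \<bullet> m = f" using mn mn' l' k by (simp add: Hom_def)
  \<comment> \<open>\<open>m\<close> is a trivial cofibration, so the fibration \<open>f\<close>
    lifts against it and the retract argument applies.\<close>
  have "is_retract_of C f (l \<bullet> n)"
    using retract_of_right_factor[of m "l \<bullet> n"] lifting_trivial_Cof_Fib[of m f] mn m f mn' l' k eq
    by (simp add: Hom_def)
  then show ?thesis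
    using ln rlp_retracts unfolding Qfib_rlp closed_under_retracts_def by blast
qed

text \<open>A lift against \<open>g\<close> from a cylinder on \<open>U\<close> relative to \<open>X\<close> is a homotopy between \<open>i \<bullet> r\<close>
  and the identity. It exists because the inclusion of both ends into the cylinder is a
  \<open>Q\<close>-equivalence as well as a cofibration.\<close>

lemma fibrewise_section_in_W:
  assumes i: "i \<in> Cof" "i \<in> Qeq" and r: "r \<in> Arr C" "Dom C r = Cod C i" "Cod C r = Dom C i"
      "r \<bullet> i = Ident C (Dom C i)"
    and g: "g \<in> Qfib" "Dom C g = Cod C i" "g \<bullet> i \<bullet> r = g"
  shows "i \<in> W"
proof -
  let ?U = "Cod C i"
  let ?id = "Ident C ?U"
  have arr: "i \<in> Arr C" "g \<in> Arr C" using i g Qfib_subset_Fib by auto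
  have U: "?U \<in> Obj C" using arr by simp
  have id_W: "?id \<in> W" by (rule Ident_in_W[OF U])
  obtain i1 i0 where po: "is_pushout C i i i1 i0" using pushout_exists arr by blast
  have sq: "square C i i i1 i0" using po unfolding is_pushout_def by blast
  note s = squareD[OF sq]
  \<comment> \<open>\<open>i0\<close> is a cobase change of \<open>i\<close>, so it inherits lifting
    against all \<open>Q\<close>-fibrations, which characterizes this class.\<close>
  have "i0 \<in> Cof \<inter> Qeq"
  proof (rule left_class_if_lifting[OF _ _ factorization_trivial_Cof_Qfib])
    show "closed_under_retracts C (Cof \<inter> Qeq)"
      using Cof_retracts Qeq_retracts unfolding closed_under_retracts_def by blast
    show "has_lifting C i0 p" if "p \<in> Qfib" for p
      using has_lifting_pushout[OF po] i that by (auto simp: Qfib_rlp rlp_def)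
  qed (use s Qfib_subset_Fib in auto)
  have "square C i i ?id ?id" by (rule squareI) (use arr U in simp_all)
  \<comment> \<open>\<open>d\<close> is the fold map; \<open>\<phi>\<close> below prescribes the
    ends of the homotopy, \<open>i \<bullet> r\<close> on \<open>i1\<close> and the identity on
    \<open>i0\<close>.\<close>
  then obtain d where d: "d \<in> Arr C" "Dom C d = Cod C i1" "Cod C d = Cod C ?id"
    "d \<bullet> i1 = ?id" "d \<bullet> i0 = ?id" by (rule pushout_desc[OF po])
  have "square C i i (i \<bullet> r) ?id" by (rule squareI) (use arr U r in simp_all)
  then obtain \<phi> where \<phi>: "\<phi> \<in> Arr C" "Dom C \<phi> = Cod C i1" "Cod C \<phi> = Cod C (i \<bullet> r)"
    "\<phi> \<bullet> i1 = i \<bullet> r" "\<phi> \<bullet> i0 = ?id" by (rule pushout_desc[OF po])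
  have cod: "Cod C d = ?U" "Cod C \<phi> = ?U" using d \<phi> arr U r by simp_all
  obtain c \<sigma> where c\<sigma>: "c \<in> Cof" "\<sigma> \<in> Fib \<inter> W" "Cod C c = Dom C \<sigma>" "\<sigma> \<bullet> c = d"
    and c\<sigma>': "c \<in> Arr C" "\<sigma> \<in> Arr C" "Dom C c = Dom C d"
      "Cod C \<sigma> = Cod C d"
    by (rule factorE_trivial_Fib[OF d(1)])
  have ends: "\<sigma> \<bullet> c \<bullet> i0 = ?id" "\<sigma> \<bullet> c \<bullet> i1 = ?id"
    using c\<sigma> c\<sigma>' s d by (simp_all add: comp_reassoc[OF c\<sigma>(4)])
  have c0: "c \<bullet> i0 \<in> W" and c1: "c \<bullet> i1 \<in> W"
    using W_cancel_left[of "c \<bullet> i0" \<sigma>] W_cancel_left[of "c \<bullet> i1" \<sigma>] ends id_W c\<sigma> c\<sigma>' s d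
    by simp_all
  have "c \<in> Qeq"
    using Qeq_cancel_right[of i0 c] c0 \<open>i0 \<in> Cof \<inter> Qeq\<close> W_subset_Qeq c\<sigma>' s d by auto
  then have lift: "has_lifting C c g" using c\<sigma>(1) g(1) by (auto simp: Qfib_rlp rlp_def)
  \<comment> \<open>On the \<open>i1\<close> end this is the hypothesis that
    \<open>i \<bullet> r\<close> lies over \<open>g\<close>; on the other end both sides are
    \<open>g\<close>.\<close>
  have "g \<bullet> \<phi> = g \<bullet> d"
    by (rule pushout_unique[OF po])
      (use arr g r s d \<phi> cod in simp_all)
  then have "square C \<phi> c g (g \<bullet> \<sigma>)"
    by (intro squareI) (use arr g c\<sigma> c\<sigma>' d \<phi> cod in simp_all)
  then obtain H where H: "H \<in> Arr C" "Dom C H = Cod C c" "Cod C H = Dom C g" "H \<bullet> c = \<phi>"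
    by (rule has_liftingE[OF lift])
  have Hends: "H \<bullet> c \<bullet> i0 = ?id" "H \<bullet> c \<bullet> i1 = i \<bullet> r"
    using H c\<sigma>' s d \<phi> by (simp_all add: comp_reassoc[OF H(4)])
  \<comment> \<open>One end of the homotopy is the identity and both end inclusions are weak
    equivalences, so first \<open>H\<close> and then its other end \<open>i \<bullet> r\<close> is
    one.\<close>
  have "H \<in> W" using W_cancel_right[of "c \<bullet> i0" H] c0 Hends id_W H c\<sigma>' s d by simp
  then have "i \<bullet> r \<in> W" using W_comp[of "c \<bullet> i1" H] c1 Hends H c\<sigma>' s d by simp
  moreover have "is_retract_of C i (i \<bullet> r)"
    unfolding is_retract_of_def
  proof (intro exI conjI)
    show "square C i i (i \<bullet> r) ?id" by fact
    show "square C r (i \<bullet> r) i ?id" by (rule squareI) (use arr U r in simp_all)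
    show "?id \<bullet> ?id = ?id" using U by simp
  qed (rule r(4))
  ultimately show ?thesis using W_retracts unfolding closed_under_retracts_def by blast
qed

text \<open>Up to a trivial fibration the comparison map is a cofibration \<open>m\<close> that is a
  \<open>Q\<close>-equivalence. Lifting the \<open>Q\<close>-fibration \<open>f\<close> against
  \<open>m\<close> gives a retraction over the base, and the fibrewise homotopy makes
  \<open>m\<close> a weak equivalence.\<close>

lemma homotopy_pullback_if_Qfib:
  assumes f: "f \<in> Qfib"
  shows "is_homotopy_pullback C W Fib (\<eta> (Dom C f)) f (Qa f) (\<eta> (Cod C f))"
proof -
  have f_arr: "f \<in> Arr C" using f Qfib_subset_Fib by auto
  obtain j p t l k where jp: "j \<in> W" "p \<in> Fib" "Cod C j = Dom C p" "p \<bullet> j = Qa f"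
    and pb: "is_pullback C t l p (\<eta> (Cod C f))" and
    k: "k \<in> Qeq" "Dom C k = Dom C f" "Cod C k = Dom C t" "t \<bullet> k = j \<bullet> \<eta> (Dom C f)"
      "l \<in> Qfib" "l \<bullet> k = f"
    by (rule Qfib_replacement[OF f_arr]) blast
  have l: "l \<in> Arr C" "Dom C l = Dom C t"
    using pb unfolding is_pullback_def square_def by auto
  have k_arr: "k \<in> Arr C" by (rule Qeq_arr[OF k(1)])
  have l_cod: "Cod C l = Cod C f" using k l k_arr comp_simps(3)[of k l] by simp
  obtain m n where mn: "m \<in> Cof" "n \<in> Fib \<inter> W" "Cod C m = Dom C n" "n \<bullet> m = k"
    and mn': "m \<in> Arr C" "n \<in> Arr C" "Dom C m = Dom C k" "Cod C n = Cod C k"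
    by (rule factorE_trivial_Fib[OF k_arr])
  have m: "m \<in> Qeq" using Qeq_cancel_left[of m n] mn mn' k W_subset_Qeq by auto
  have ln: "l \<bullet> n \<in> Qfib"
    using Qfib_comp_trivial_Fib[of n l] mn(2) mn' k(5) k(3) l by simp
  have lift: "has_lifting C m f" using f m mn(1) by (auto simp: Qfib_rlp rlp_def)
  have "square C (Ident C (Dom C f)) m f (l \<bullet> n)"
    by (rule squareI) (use f_arr mn mn' l l_cod k in simp_all)
  then obtain r where r: "r \<in> Arr C" "Dom C r = Cod C m" "Cod C r = Dom C f"
    "r \<bullet> m = Ident C (Dom C f)" "f \<bullet> r = l \<bullet> n" by (rule has_liftingE[OF lift])
  \<comment> \<open>Since \<open>(l \<bullet> n) \<bullet> m\<close> is \<open>f\<close>, this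
    expresses that \<open>r\<close> lies over the base.\<close>
  have "(l \<bullet> n) \<bullet> m \<bullet> r = l \<bullet> n"
    using r mn mn' l k k_arr by (simp add: comp_reassoc[OF mn(4)] comp_reassoc[OF k(6)])
  then have "m \<in> W"
    using fibrewise_section_in_W[of m r "l \<bullet> n"] mn m r ln mn' l k by simp
  then have "k \<in> W" using W_comp[of m n] mn mn' by auto
  moreover have "square C (\<eta> (Dom C f)) f (Qa f) (\<eta> (Cod C f))"
    by (rule squareI) (use f_arr eta_natural[OF f_arr] in simp_all)
  moreover have "k \<in> Hom C (Dom C (\<eta> (Dom C f))) (Dom C t)"
    using k k_arr f_arr by (simp add: Hom_def)
  ultimately show ?thesis
    using jp pb k unfolding is_homotopy_pullback_def by blast
qed

section \<open>Right properness and the conclusion from hypotheses (a) to (e)\<close>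

lemma Q_right_proper: "right_proper C Qeq Qfib"
  using Qeq_pullback unfolding right_proper_def by blast

end

theorem theoremA8:
  fixes \<kappa> :: "'i rel" and C :: "('o, 'a) cat" and W Cof Fib :: "'a set"
    and Qo :: "'o \<Rightarrow> 'o" and Qa :: "'a \<Rightarrow> 'a" and \<eta> :: "'o \<Rightarrow> 'a"
  assumes "homotopy_localization \<kappa> C W Cof Fib Qo Qa \<eta>"
    and "left_proper C W Cof" and "right_proper C W Fib"
    and a: "\<forall>f\<in>Arr C. \<eta> (Cod C f) \<cdot>\<^bsub>C\<^esub> f = Qa f \<cdot>\<^bsub>C\<^esub> \<eta> (Dom C f)"
    and b: "closed_under_retracts C (Q_equivalences C W Qa)"
    and c: "two_out_of_three C (Q_equivalences C W Qa)"
    and d: "\<forall>f12 f13 f24 f34. square C f12 f13 f24 f34 \<longrightarrow>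
              (\<exists>g12 g13 g24 g34 c1 c2 c3 c4.
                 localization_cube C W Qo Qa \<eta> f12 f13 f24 f34 g12 g13 g24 g34 c1 c2 c3 c4)"
    and e: "\<forall>t g f h. is_pullback C t g f h \<and> h \<in> Q_fibrations C W Cof Qa \<and>
              f \<in> Q_equivalences C W Qa \<longrightarrow> g \<in> Q_equivalences C W Qa"
  shows "model_category \<kappa> C (Q_equivalences C W Qa) (Q_cofibrations Cof) (Q_fibrations C W Cof Qa) \<and>
    right_proper C (Q_equivalences C W Qa) (Q_fibrations C W Cof Qa) \<and>
    (\<forall>f\<in>Arr C. f \<in> Fib \<and> is_homotopy_pullback C W Fib (\<eta> (Dom C f)) f (Qa f) (\<eta> (Cod C f)) \<longrightarrow>
       f \<in> Q_fibrations C W Cof Qa) \<and>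
    ((\<forall>f12 f13 f24 f34. square C f12 f13 f24 f34 \<longrightarrow>
        (\<exists>g12 g13 g24 g34 c1 c2 c3 c4.
           localization_cube C W Qo Qa \<eta> f12 f13 f24 f34 g12 g13 g24 g34 c1 c2 c3 c4 \<and>
           factors_through_eta C Qa \<eta> f12 g12 c1 c2 \<and> factors_through_eta C Qa \<eta> f13 g13 c1 c3 \<and>
           factors_through_eta C Qa \<eta> f24 g24 c2 c4 \<and> factors_through_eta C Qa \<eta> f34 g34 c3 c4)) \<longrightarrow>
     (\<forall>f\<in>Q_fibrations C W Cof Qa.
        f \<in> Fib \<and> is_homotopy_pullback C W Fib (\<eta> (Dom C f)) f (Qa f) (\<eta> (Cod C f))))"
proof -
  interpret homotopy_localization \<kappa> C W Cof Fib Qo Qa \<eta> by fact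
  interpret square_homotopy_localization \<kappa> C W Cof Fib Qo Qa \<eta>
  proof
    show "right_proper C W Fib" by fact
    show "Comp C (\<eta> (Cod C f)) f = Comp C (Qa f) (\<eta> (Dom C f))" if "f \<in> Arr C" for f
      using a that by blast
    show "\<exists>g12 g13 g24 g34 c1 c2 c3 c4.
        localization_cube C W Qo Qa \<eta> f12 f13 f24 f34 g12 g13 g24 g34 c1 c2 c3 c4"
      if "square C f12 f13 f24 f34" for f12 f13 f24 f34
      using d that by blast
    show "g \<in> Q_equivalences C W Qa"
      if "is_pullback C t g f h" "h \<in> Q_fibrations C W Cof Qa" "f \<in> Q_equivalences C W Qa"
      for t g f h
      using e that by blast
  qed (fact b c)+
  show ?thesis
    using Q_model_category Q_right_proper Qfib_if_homotopy_pullback homotopy_pullback_if_Qfib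
      Qfib_subset_Fib by blast
qed

end
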